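(* Let $T>0$, $N\in\mathbb{Z}$, and let $F(t,x)$ be continuous and $T$-periodic in $t$. Let $x(t)$ be a $T$-periodic solution with winding number $N$ of $$\frac{d}{dt}\left(\frac{\dot x}{\sqrt{1-\dot x^2}}\right)=F(t,x).$$ Then $$\left|\frac{2N\pi}{T}\right|<1.$$
   Context: A $T$-periodic solution with winding number $N$ is a solution $x:\mathbb{R}\to\mathbb{R}$ such that $x(t+T)=x(t)+2N\pi$ for all $t\in\mathbb{R}$. A solution is a $C^1$ function with $|\dot x(t)|<1$ for all $t$ such that $\dot x/\sqrt{1-\dot x^2}$ is $C^1$ and the equation holds. *)

theory Defs
  imports "HOL-Analysis.Analysis"
begin

definition momentum :: "(real \<Rightarrow> real) \<Rightarrow> real \<Rightarrow> real" where
  "momentum x t = deriv x t / sqrt (1 - (deriv x t)\<^sup>2)"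

text \<open>Solutions are classical and defined on the whole line. The condition \<open>C1_differentiable_on UNIV\<close>
  guarantees that every \<open>deriv\<close> occurring below is a genuine derivative.\<close>

definition is_solution :: "(real \<Rightarrow> real \<Rightarrow> real) \<Rightarrow> (real \<Rightarrow> real) \<Rightarrow> bool" where
  "is_solution F x \<longleftrightarrow>
     x C1_differentiable_on UNIV \<and>
     (\<forall>t. \<bar>deriv x t\<bar> < 1) \<and>
     momentum x C1_differentiable_on UNIV \<and>
     (\<forall>t. deriv (momentum x) t = F t (x t))"

definition is_periodic_solution ::
  "(real \<Rightarrow> real \<Rightarrow> real) \<Rightarrow> real \<Rightarrow> int \<Rightarrow> (real \<Rightarrow> real) \<Rightarrow> bool" where
  "is_periodic_solution F T N x \<longleftrightarrow>
     is_solution F x \<and> (\<forall>t. x (t + T) = x t + 2 * of_int N * pi)"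

end

theory Submission
  imports Defs
begin

text \<open>The number \<open>2 * N * pi / T\<close> is the mean slope of \<open>x\<close> over one period, so by the mean
  value theorem it is attained as a velocity of \<open>x\<close>; the relativistic constraint keeps every
  velocity strictly below \<open>1\<close> in absolute value.\<close>

theorem proposition1:
  fixes T :: real and N :: int
    and F :: "real \<Rightarrow> real \<Rightarrow> real" and x :: "real \<Rightarrow> real"
  assumes "T > 0"
    and "continuous_on UNIV (\<lambda>(t, y). F t y)"
    and "\<And>t y. F (t + T) y = F t y"
    and "is_periodic_solution F T N x"
  shows "\<bar>2 * of_int N * pi / T\<bar> < 1"
proof -
  have sol: "is_solution F x" and shift: "x (0 + T) = x 0 + 2 * of_int N * pi"
    using assms(4) unfolding is_periodic_solution_def by blast+
  have speed: "\<bar>deriv x t\<bar> < 1" for t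
    using sol by (simp add: is_solution_def)
  have "x differentiable at t" for t
    using sol by (auto simp: is_solution_def C1_differentiable_on_eq)
  then have "(x has_real_derivative deriv x t) (at t)" for t
    by (simp add: DERIV_deriv_iff_real_differentiable)
  with \<open>T > 0\<close> obtain z where "x T - x 0 = (T - 0) * deriv x z"
    using MVT2[of 0 T x "deriv x"] by blast
  with shift \<open>T > 0\<close> have "2 * of_int N * pi / T = deriv x z"
    by (simp add: field_simps)
  with speed show ?thesis
    by simp
qed

end
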